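(* Let $f=\sum_{p=1}^P f_p$ with $f_p:\mathbb{R}^n\to\mathbb{R}$ continuously differentiable for $p=1,\dots,P$. Assume that for every $w_0\in\mathbb{R}^n$ the level set $\mathcal{L}(w_0)=\{w\in\mathbb{R}^n: f(w)\le f(w_0)\}$ is compact, and that there exists $L>0$ such that $\|\nabla f_p(u)-\nabla f_p(v)\|\le L\|u-v\|$ for all $u,v\in\mathbb{R}^n$ and all $p=1,\dots,P$. Let $\{w^k\}$ be any sequence of points produced by Algorithm CMA (described in the context). Then $\{w^k\}$ admits limit points, and at least one limit point $\bar w$ of $\{w^k\}$ is stationary, i.e. $\nabla f(\bar w)=0$.
   Context: Norms are Euclidean. Inner_Cycle$(w,\zeta)$, for $w\in\mathbb{R}^n$, $\zeta>0$: choose a permutation $(h_1,\dots,h_P)$ of $\{1,\dots,P\}$ (arbitrary, possibly different at each call); set $\widetilde w_0=w$; for $i=1,\dots,P$ set $\widetilde d_i=-\nabla f_{h_i}(\widetilde w_{i-1})$ and $\widetilde w_i=\widetilde w_{i-1}+\zeta\widetilde d_i$. Return $(\widetilde w,d)$ with $\widetilde w=\widetilde w_P$ and $d=\sum_{i=1}^P\widetilde d_i$ (so $\widetilde w=w+\zeta d$). EDFL$(w,d,\zeta;\gamma,\delta)$ (Extrapolation Derivative-Free Linesearch): set $\alpha=\zeta$. If $f(w+\alpha d)>f(w)-\gamma\alpha\|d\|^2$, return $0$. Otherwise, while $f(w+(\alpha/\delta)d)\le\min\{f(w)-\gamma(\alpha/\delta)\|d\|^2,\ f(w+\alpha d)\}$,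 replace $\alpha$ by $\alpha/\delta$; when the while loop stops return $\alpha$. Algorithm CMA: parameters $\zeta^0>0$, $\theta\in(0,1)$, $\tau>0$, $\gamma\in(0,1)$, $\delta\in(0,1)$, starting point $w^0\in\mathbb{R}^n$. For $k=0,1,2,\dots$: 1. Compute $(\widetilde w^k,d^k)=$ Inner_Cycle$(w^k,\zeta^k)$. 2. If $f(\widetilde w^k)\le f(w^k)-\gamma\zeta^k$: set $\zeta^{k+1}=\zeta^k$ and $\alpha^k=\zeta^k$. 3. Else, if $\|d^k\|\le\tau\zeta^k$: set $\zeta^{k+1}=\theta\zeta^k$, and $\alpha^k=\zeta^k$ if $f(\widetilde w^k)\le f(w^0)$, $\alpha^k=0$ otherwise. 4. Else, compute $\widetilde\alpha^k=$ EDFL$(w^k,d^k,\zeta^k;\gamma,\delta)$. (4a) If $\widetilde\alpha^k\|d^k\|^2\le\tau\zeta^k$: set $\zeta^{k+1}=\theta\zeta^k$, and $\alpha^k=\widetilde\alpha^k$ if $\widetilde\alpha^k>0$; $\alpha^k=\zeta^k$ if $\widetilde\alpha^k=0$ and $f(\widetilde w^k)\le f(w^0)$; $\alpha^k=0$ otherwise. (4b) Otherwise: set $\zeta^{k+1}=\zeta^k$ and $\alpha^k=\widetilde\alpha^k$. 5. Set $y^k=w^k+\alpha^kd^k$ and select any $w^{k+1}\in\mathbb{R}^n$ such that $f(w^{k+1})\le f(y^k)$. *)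

theory Defs
  imports "HOL-Analysis.Analysis" "HOL-Combinatorics.Permutations"
    "HOL-Library.While_Combinator"
begin

definition gradient :: "('a::euclidean_space \<Rightarrow> real) \<Rightarrow> 'a \<Rightarrow> 'a" where
  "gradient f x = (THE D. GDERIV f x :> D)"

lemma GDERIV_unique:
  fixes f :: "'a::euclidean_space \<Rightarrow> real"
  assumes "GDERIV f x :> D" "GDERIV f x :> E"
  shows "D = E"
proof -
  have "(\<lambda>h. h \<bullet> D) = (\<lambda>h. h \<bullet> E)"
    using assms unfolding gderiv_def by (rule has_derivative_unique)
  then have "h \<bullet> D = h \<bullet> E" for h by metis
  then have "(D - E) \<bullet> (D - E) = 0"
    by (simp add: inner_diff_right)
  then show ?thesis by simp
qed

lemma gradient_eqI:
  fixes f :: "'a::euclidean_space \<Rightarrow> real"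
  shows "GDERIV f x :> D \<Longrightarrow> gradient f x = D"
  unfolding gradient_def by (blast intro: GDERIV_unique)

lemma differentiable_imp_GDERIV_gradient:
  fixes f :: "'a::euclidean_space \<Rightarrow> real"
  assumes "f differentiable (at x)"
  shows "GDERIV f x :> gradient f x"
proof -
  obtain f' where f': "(f has_derivative f') (at x)"
    using assms unfolding differentiable_def by blast
  then have lin: "linear f'" by (rule has_derivative_linear)
  have "f' = (\<lambda>h. h \<bullet> adjoint f' 1)"
    using adjoint_works[OF lin, of _ 1] by (simp add: fun_eq_iff)
  with f' have "GDERIV f x :> adjoint f' 1"
    unfolding gderiv_def by metis
  then show ?thesis using gradient_eqI by metis
qed

definition continuously_differentiable :: "('a::euclidean_space \<Rightarrow> real) \<Rightarrow> bool" where
  "continuously_differentiable f \<longleftrightarrow>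
    (\<forall>x. f differentiable (at x)) \<and> continuous_on UNIV (gradient f)"

definition seq_limit_point :: "(nat \<Rightarrow> 'a::topological_space) \<Rightarrow> 'a \<Rightarrow> bool" where
  "seq_limit_point w x \<longleftrightarrow> (\<exists>r. strict_mono r \<and> (w \<circ> r) \<longlonglongrightarrow> x)"

definition total_sum :: "(nat \<Rightarrow> 'a \<Rightarrow> real) \<Rightarrow> nat \<Rightarrow> 'a \<Rightarrow> real" where
  "total_sum fs P w = (\<Sum>p=1..P. fs p w)"

text \<open>The order \<open>(h\<^sub>1, \<dots>, h\<^sub>P)\<close> in which the component functions are visited is represented
  by a function \<open>h\<close> that permutes \<open>{1..P}\<close>.\<close>

fun inner_point ::
  "(nat \<Rightarrow> 'a::euclidean_space \<Rightarrow> real) \<Rightarrow> (nat \<Rightarrow> nat) \<Rightarrow> real \<Rightarrow> 'a \<Rightarrow> nat \<Rightarrow> 'a" where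
  "inner_point fs h \<zeta> w 0 = w"
| "inner_point fs h \<zeta> w (Suc i) =
     inner_point fs h \<zeta> w i + \<zeta> *\<^sub>R (- gradient (fs (h (Suc i))) (inner_point fs h \<zeta> w i))"

definition inner_direction ::
  "(nat \<Rightarrow> 'a::euclidean_space \<Rightarrow> real) \<Rightarrow> (nat \<Rightarrow> nat) \<Rightarrow> real \<Rightarrow> 'a \<Rightarrow> nat \<Rightarrow> 'a" where
  "inner_direction fs h \<zeta> w i = - gradient (fs (h i)) (inner_point fs h \<zeta> w (i - 1))"

text \<open>A relation rather than a function: each call may use a different permutation.\<close>

definition inner_cycle ::
  "(nat \<Rightarrow> 'a::euclidean_space \<Rightarrow> real) \<Rightarrow> nat \<Rightarrow> 'a \<Rightarrow> real \<Rightarrow> 'a \<Rightarrow> 'a \<Rightarrow> bool" where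
  "inner_cycle fs P w \<zeta> w' d \<longleftrightarrow>
    (\<exists>h. h permutes {1..P} \<and>
         w' = inner_point fs h \<zeta> w P \<and>
         d = (\<Sum>i=1..P. inner_direction fs h \<zeta> w i))"

text \<open>The value is \<open>None\<close> exactly if the extrapolation loop does not terminate.\<close>

definition edfl ::
  "('a::euclidean_space \<Rightarrow> real) \<Rightarrow> 'a \<Rightarrow> 'a \<Rightarrow> real \<Rightarrow> real \<Rightarrow> real \<Rightarrow> real option" where
  "edfl f w d \<zeta> \<gamma> \<delta> =
    (if f (w + \<zeta> *\<^sub>R d) > f w - \<gamma> * \<zeta> * (norm d)\<^sup>2 then Some 0
     else while_option
       (\<lambda>\<alpha>. f (w + (\<alpha> / \<delta>) *\<^sub>R d)
              \<le> min (f w - \<gamma> * (\<alpha> / \<delta>) * (norm d)\<^sup>2) (f (w + \<alpha> *\<^sub>R d)))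
       (\<lambda>\<alpha>. \<alpha> / \<delta>) \<zeta>)"

text \<open>Steps 2--4 of an iteration of CMA, where \<open>w0\<close> is the starting point of the whole run, and
  \<open>w\<close>, \<open>\<zeta>\<close>, \<open>wt\<close>, \<open>d\<close> are the current point, the current stepsize and the output of the inner
  cycle; \<open>\<zeta>'\<close> is the next stepsize and \<open>\<alpha>\<close> the step taken along \<open>d\<close>.\<close>

definition cma_stepsizes ::
  "('a::euclidean_space \<Rightarrow> real) \<Rightarrow> real \<Rightarrow> real \<Rightarrow> real \<Rightarrow> real \<Rightarrow>
   'a \<Rightarrow> 'a \<Rightarrow> real \<Rightarrow> 'a \<Rightarrow> 'a \<Rightarrow> real \<Rightarrow> real \<Rightarrow> bool" where
  "cma_stepsizes f \<theta> \<tau> \<gamma> \<delta> w0 w \<zeta> wt d \<zeta>' \<alpha> \<longleftrightarrow>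
    (if f wt \<le> f w - \<gamma> * \<zeta> then \<zeta>' = \<zeta> \<and> \<alpha> = \<zeta>
     else if norm d \<le> \<tau> * \<zeta> then
       \<zeta>' = \<theta> * \<zeta> \<and> \<alpha> = (if f wt \<le> f w0 then \<zeta> else 0)
     else
       (\<exists>\<alpha>t. edfl f w d \<zeta> \<gamma> \<delta> = Some \<alpha>t \<and>
         (if \<alpha>t * (norm d)\<^sup>2 \<le> \<tau> * \<zeta> then
            \<zeta>' = \<theta> * \<zeta> \<and>
            \<alpha> = (if \<alpha>t > 0 then \<alpha>t
                 else if \<alpha>t = 0 \<and> f wt \<le> f w0 then \<zeta>
                 else 0)
          else \<zeta>' = \<zeta> \<and> \<alpha> = \<alpha>t)))"

definition cma_sequence ::
  "(nat \<Rightarrow> 'a::euclidean_space \<Rightarrow> real) \<Rightarrow> nat \<Rightarrow> real \<Rightarrow> real \<Rightarrow> real \<Rightarrow> real \<Rightarrow> real \<Rightarrow>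
   (nat \<Rightarrow> 'a) \<Rightarrow> bool" where
  "cma_sequence fs P \<zeta>0 \<theta> \<tau> \<gamma> \<delta> w \<longleftrightarrow>
    (\<exists>\<zeta>. \<zeta> 0 = \<zeta>0 \<and>
      (\<forall>k. \<exists>wt d \<alpha>.
        inner_cycle fs P (w k) (\<zeta> k) wt d \<and>
        cma_stepsizes (total_sum fs P) \<theta> \<tau> \<gamma> \<delta> (w 0) (w k) (\<zeta> k) wt d (\<zeta> (Suc k)) \<alpha> \<and>
        total_sum fs P (w (Suc k)) \<le> total_sum fs P (w k + \<alpha> *\<^sub>R d)))"

end

theory Submission imports Defs begin

text \<open>
  Either the stepsize \<open>\<zeta>\<^sup>k\<close> is kept and \<open>f\<close> drops by a fixed multiple of \<open>\<zeta>\<^sup>k\<close>, or it is multiplied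
  by \<open>\<theta>\<close>. Since \<open>f\<close> is bounded below on the level set of \<open>w\<^sup>0\<close>, which the run never leaves, the
  second alternative occurs infinitely often, so \<open>\<zeta>\<^sup>k\<close> tends to \<open>0\<close>. Along a convergent subsequence
  of such iterations, with limit \<open>x\<close>, the whole inner cycle collapses to \<open>x\<close> and hence \<open>d\<^sup>k\<close> tends
  to \<open>- \<nabla>f(x)\<close>. If \<open>\<nabla>f(x) \<noteq> 0\<close>, a reduced stepsize means that \<open>f\<close> fails to decrease by
  \<open>\<gamma> (b - a) \<parallel>d\<^sup>k\<parallel>\<^sup>2\<close> on some segment \<open>w\<^sup>k + [a, b] d\<^sup>k\<close> with \<open>b\<close> of order \<open>\<zeta>\<^sup>k\<close>, and the mean
  value theorem yields \<open>\<parallel>\<nabla>f(x)\<parallel>\<^sup>2 \<le> \<gamma> \<parallel>\<nabla>f(x)\<parallel>\<^sup>2\<close>, which is impossible.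
\<close>

section \<open>Gradients of finite sums and the mean value theorem on segments\<close>

lemma GDERIV_sum:
  assumes "\<And>i. i \<in> I \<Longrightarrow> GDERIV (f i) x :> D i"
  shows "GDERIV (\<lambda>x. \<Sum>i\<in>I. f i x) x :> (\<Sum>i\<in>I. D i)"
  using assms unfolding gderiv_def inner_sum_right by (rule has_derivative_sum)

lemma GDERIV_total_sum:
  assumes "\<And>p. p \<in> {1..P} \<Longrightarrow> continuously_differentiable (fs p)"
  shows "GDERIV (total_sum fs P) x :> (\<Sum>p=1..P. gradient (fs p) x)"
  unfolding total_sum_def[abs_def]
  using assms
  by (intro GDERIV_sum differentiable_imp_GDERIV_gradient) (simp add: continuously_differentiable_def)

lemma gradient_total_sum:
  assumes "\<And>p. p \<in> {1..P} \<Longrightarrow> continuously_differentiable (fs p)"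
  shows "gradient (total_sum fs P) x = (\<Sum>p=1..P. gradient (fs p) x)"
  using assms by (intro gradient_eqI GDERIV_total_sum)

lemma continuously_differentiable_total_sum:
  assumes "\<And>p. p \<in> {1..P} \<Longrightarrow> continuously_differentiable (fs p)"
  shows "continuously_differentiable (total_sum fs P)"
  unfolding continuously_differentiable_def
proof
  show "\<forall>x. total_sum fs P differentiable at x"
    using GDERIV_total_sum[of P fs] assms unfolding gderiv_def differentiable_def by metis
  have "gradient (total_sum fs P) = (\<lambda>x. \<Sum>p=1..P. gradient (fs p) x)"
    using assms by (intro ext gradient_total_sum)
  moreover have "continuous_on UNIV (\<lambda>x. \<Sum>p=1..P. gradient (fs p) x)"
    using assms by (intro continuous_on_sum) (simp add: continuously_differentiable_def)
  ultimately show "continuous_on UNIV (gradient (total_sum fs P))"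
    by simp
qed

lemma GDERIV_mvt_segment:
  assumes GD: "\<And>x. GDERIV f x :> G x" and "a < b"
  obtains t where "a < t" "t < b" "f (x + b *\<^sub>R d) - f (x + a *\<^sub>R d) = (b - a) * (G (x + t *\<^sub>R d) \<bullet> d)"
proof -
  have "((\<lambda>t. f (x + t *\<^sub>R d)) has_derivative (\<lambda>s. s * (G (x + t *\<^sub>R d) \<bullet> d))) (at t)" for t
  proof -
    have "(f has_derivative (\<lambda>h. h \<bullet> G (x + t *\<^sub>R d))) (at (x + t *\<^sub>R d))"
      using GD unfolding gderiv_def .
    then have "((\<lambda>t. f (x + t *\<^sub>R d)) has_derivative (\<lambda>s. (s *\<^sub>R d) \<bullet> G (x + t *\<^sub>R d))) (at t)"
      by (rule has_derivative_compose[rotated]) (auto intro!: derivative_eq_intros)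
    then show ?thesis
      by (simp add: inner_commute)
  qed
  from mvt_simple[OF \<open>a < b\<close> has_derivative_at_withinI[OF this]] that show ?thesis
    by auto
qed

section \<open>The inner cycle and its limit for vanishing stepsizes\<close>

lemma inner_point_eq:
  "inner_point fs h \<zeta> w n = w + \<zeta> *\<^sub>R (\<Sum>i=1..n. inner_direction fs h \<zeta> w i)"
  by (induction n) (simp_all add: inner_direction_def algebra_simps)

lemma inner_cycle_endpoint:
  "inner_cycle fs P w \<zeta> wt d \<Longrightarrow> wt = w + \<zeta> *\<^sub>R d"
  unfolding inner_cycle_def using inner_point_eq by blast

text \<open>One inner step displaces the point by \<open>\<zeta> k\<close> times a component
  gradient. By the Lipschitz bound these gradients stay bounded while the current inner point
  approaches \<open>x\<close>, so each displacement vanishes, and there are at most \<open>P\<close>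
  of them.\<close>

lemma inner_point_tendsto:
  fixes x :: "'a::euclidean_space"
  assumes h: "\<And>k. h k permutes {1..P}"
    and Lip: "\<And>p u v. p \<in> {1..P} \<Longrightarrow> norm (gradient (fs p) u - gradient (fs p) v) \<le> L * norm (u - v)"
    and w: "w \<longlonglongrightarrow> x" and \<zeta>: "\<zeta> \<longlonglongrightarrow> 0"
    and "n \<le> P"
  shows "(\<lambda>k. inner_point fs (h k) (\<zeta> k) (w k) n) \<longlonglongrightarrow> x"
  using \<open>n \<le> P\<close>
proof (induction n)
  case 0
  then show ?case using w by simp
next
  case (Suc n)
  define X where "X k = inner_point fs (h k) (\<zeta> k) (w k) n" for k
  \<comment> \<open>The component visited varies with \<open>k\<close>; \<open>B\<close> dominates
    the gradient norm at \<open>x\<close> of every component at once.\<close>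
  define B where "B = (\<Sum>p=1..P. norm (gradient (fs p) x))"
  have X: "X \<longlonglongrightarrow> x"
    using Suc unfolding X_def by simp
  have bound: "norm (\<zeta> k *\<^sub>R (- gradient (fs (h k (Suc n))) (X k))) \<le> \<bar>\<zeta> k\<bar> * (B + L * norm (X k - x))"
    for k
  proof -
    have p: "h k (Suc n) \<in> {1..P}"
      using permutes_in_image[OF h] Suc.prems by simp
    have "norm (gradient (fs (h k (Suc n))) (X k))
        \<le> norm (gradient (fs (h k (Suc n))) x) + L * norm (X k - x)"
      using Lip[OF p, of "X k" x] norm_triangle_sub[of "gradient (fs (h k (Suc n))) (X k)" "gradient (fs (h k (Suc n))) x"]
      by linarith
    also have "norm (gradient (fs (h k (Suc n))) x) \<le> B"
      unfolding B_def using p by (intro member_le_sum) auto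
    finally show ?thesis
      by (simp add: mult_left_mono)
  qed
  have "(\<lambda>k. \<bar>\<zeta> k\<bar> * (B + L * norm (X k - x))) \<longlonglongrightarrow> 0 * (B + L * norm (x - x))"
    using tendsto_rabs_zero[OF \<zeta>] X by (intro tendsto_intros)
  then have "(\<lambda>k. \<bar>\<zeta> k\<bar> * (B + L * norm (X k - x))) \<longlonglongrightarrow> 0"
    by simp
  then have "(\<lambda>k. \<zeta> k *\<^sub>R (- gradient (fs (h k (Suc n))) (X k))) \<longlonglongrightarrow> 0"
    by (rule Lim_null_comparison[OF always_eventually, rotated]) (use bound in blast)
  from tendsto_add[OF X this] show ?case
    by (simp add: X_def)
qed

text \<open>Every component is visited exactly once, at an inner point tending to \<open>x\<close>.
  The order of visits therefore disappears in the limit, and no convergence of the permutations is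
  required.\<close>

lemma inner_cycle_direction_tendsto:
  fixes x :: "'a::euclidean_space"
  assumes cyc: "\<And>k. inner_cycle fs P (w k) (\<zeta> k) (wt k) (d k)"
    and Lip: "\<And>p u v. p \<in> {1..P} \<Longrightarrow> norm (gradient (fs p) u - gradient (fs p) v) \<le> L * norm (u - v)"
    and w: "w \<longlonglongrightarrow> x" and \<zeta>: "\<zeta> \<longlonglongrightarrow> 0"
  shows "d \<longlonglongrightarrow> - (\<Sum>p=1..P. gradient (fs p) x)"
proof -
  obtain h where h: "\<And>k. h k permutes {1..P}"
    and d: "\<And>k. d k = (\<Sum>i=1..P. inner_direction fs (h k) (\<zeta> k) (w k) i)"
    using cyc unfolding inner_cycle_def by metis
  define X where "X i k = inner_point fs (h k) (\<zeta> k) (w k) (i - 1)" for i k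
  have X: "X i \<longlonglongrightarrow> x" if "i \<in> {1..P}" for i
    unfolding X_def using that by (intro inner_point_tendsto[OF h Lip w \<zeta>]) auto
  have bound: "norm (d k - - (\<Sum>p=1..P. gradient (fs p) x)) \<le> (\<Sum>i=1..P. L * norm (X i k - x))" for k
  proof -
    \<comment> \<open>Reindexing by \<open>h k\<close> pairs each summand of \<open>d k\<close> with
      the gradient at \<open>x\<close> of the same component, so the Lipschitz bound applies term by
      term.\<close>
    have "(\<Sum>p=1..P. gradient (fs p) x) = (\<Sum>i=1..P. gradient (fs (h k i)) x)"
      using sum.permute[OF h, of "\<lambda>p. gradient (fs p) x"] by (simp add: o_def)
    then have "d k - - (\<Sum>p=1..P. gradient (fs p) x)
        = (\<Sum>i=1..P. gradient (fs (h k i)) x - gradient (fs (h k i)) (X i k))"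
      by (simp add: d inner_direction_def X_def sum_negf sum_subtractf)
    also have "norm \<dots> \<le> (\<Sum>i=1..P. norm (gradient (fs (h k i)) x - gradient (fs (h k i)) (X i k)))"
      by (rule norm_sum)
    also have "\<dots> \<le> (\<Sum>i=1..P. L * norm (X i k - x))"
    proof (rule sum_mono)
      fix i assume "i \<in> {1..P}"
      then show "norm (gradient (fs (h k i)) x - gradient (fs (h k i)) (X i k)) \<le> L * norm (X i k - x)"
        using Lip[of "h k i" x "X i k"] permutes_in_image[OF h] by (simp add: norm_minus_commute)
    qed
    finally show ?thesis .
  qed
  have "(\<lambda>k. \<Sum>i=1..P. L * norm (X i k - x)) \<longlonglongrightarrow> (\<Sum>i=1..P. L * norm (x - x))"
    using X by (intro tendsto_intros)
  then have "(\<lambda>k. \<Sum>i=1..P. L * norm (X i k - x)) \<longlonglongrightarrow> 0"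
    by simp
  then have "(\<lambda>k. d k - - (\<Sum>p=1..P. gradient (fs p) x)) \<longlonglongrightarrow> 0"
    by (rule Lim_null_comparison[OF always_eventually, rotated]) (use bound in blast)
  then show ?thesis
    by (simp only: LIM_zero_iff)
qed

section \<open>Outcomes of the linesearch and of one iteration\<close>

lemma edfl_cases:
  assumes "edfl f w d \<zeta> \<gamma> \<delta> = Some \<alpha>" "0 < \<zeta>" "0 < \<delta>"
  obtains (rejected) "\<alpha> = 0" "f (w + \<zeta> *\<^sub>R d) > f w - \<gamma> * \<zeta> * (norm d)\<^sup>2"
  | (accepted) "\<alpha> > 0" "f (w + \<alpha> *\<^sub>R d) \<le> f w - \<gamma> * \<alpha> * (norm d)\<^sup>2"
      "f (w + (\<alpha> / \<delta>) *\<^sub>R d) > min (f w - \<gamma> * (\<alpha> / \<delta>) * (norm d)\<^sup>2) (f (w + \<alpha> *\<^sub>R d))"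
proof (cases "f (w + \<zeta> *\<^sub>R d) > f w - \<gamma> * \<zeta> * (norm d)\<^sup>2")
  case True
  with assms rejected show ?thesis
    by (simp add: edfl_def)
next
  case False
  let ?b = "\<lambda>\<alpha>. f (w + (\<alpha> / \<delta>) *\<^sub>R d) \<le> min (f w - \<gamma> * (\<alpha> / \<delta>) * (norm d)\<^sup>2) (f (w + \<alpha> *\<^sub>R d))"
  have while: "while_option ?b (\<lambda>\<alpha>. \<alpha> / \<delta>) \<zeta> = Some \<alpha>"
    using assms(1) False unfolding edfl_def by (simp only: if_False)
  \<comment> \<open>This is a loop invariant: the failed rejection test gives it at
    \<open>\<zeta>\<close>, and the guard contains it for
    \<open>\<alpha> / \<delta>\<close>.\<close>
  have "\<alpha> > 0 \<and> f (w + \<alpha> *\<^sub>R d) \<le> f w - \<gamma> * \<alpha> * (norm d)\<^sup>2"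
    by (rule while_option_rule[OF _ while]) (use assms False in auto)
  moreover have "\<not> ?b \<alpha>"
    using while_option_stop[OF while] .
  ultimately show ?thesis
    using accepted by (meson not_le)
qed

text \<open>Rejecting the initial step of the linesearch gives \<open>a = 0\<close>, \<open>b = \<zeta>\<close>; if the extrapolation stops
  at \<open>\<alpha>\<close>, then \<open>b = \<alpha> / \<delta>\<close>, and \<open>a\<close> is \<open>0\<close> or \<open>\<alpha>\<close> according to which term of the minimum is
  exceeded.\<close>

definition insufficient_decrease ::
  "('a::euclidean_space \<Rightarrow> real) \<Rightarrow> real \<Rightarrow> real \<Rightarrow> real \<Rightarrow> 'a \<Rightarrow> real \<Rightarrow> 'a \<Rightarrow> real \<Rightarrow> real \<Rightarrow> bool" where
  "insufficient_decrease f \<tau> \<gamma> \<delta> w \<zeta> d a b \<longleftrightarrow>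
    0 \<le> a \<and> a < b \<and> (b \<le> \<zeta> \<or> b * (norm d)\<^sup>2 \<le> \<tau> * \<zeta> / \<delta>) \<and>
    f (w + b *\<^sub>R d) - f (w + a *\<^sub>R d) \<ge> - \<gamma> * (b - a) * (norm d)\<^sup>2"

text \<open>Sorts the branches of an iteration by what they offer the descent argument. A reduced
  stepsize may come with an increase from \<open>f w\<close> to \<open>f wt\<close>, so there only
  \<open>f w0\<close> is available as a bound; in exchange the failure is recorded for the
  stationarity argument.\<close>

lemma cma_stepsizes_cases:
  assumes step: "cma_stepsizes f \<theta> \<tau> \<gamma> \<delta> w0 w \<zeta> wt d \<zeta>' \<alpha>"
    and wt: "wt = w + \<zeta> *\<^sub>R d"
    and pos: "0 < \<zeta>" "0 < \<tau>" "0 < \<gamma>" "0 < \<delta>" "\<delta> < 1"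
    and w: "f w \<le> f w0"
  obtains (kept) "\<zeta>' = \<zeta>" "f (w + \<alpha> *\<^sub>R d) \<le> f w - \<gamma> * min 1 \<tau> * \<zeta>"
  | (reduced) "\<zeta>' = \<theta> * \<zeta>" "f (w + \<alpha> *\<^sub>R d) \<le> f w0"
      "norm d \<le> \<tau> * \<zeta> \<or> (\<exists>a b. insufficient_decrease f \<tau> \<gamma> \<delta> w \<zeta> d a b)"
proof -
  \<comment> \<open>The direct test yields a decrease of \<open>\<gamma> * \<zeta>\<close>, a
    linesearch that keeps the stepsize one of \<open>\<gamma> * (\<tau> * \<zeta>)\<close>; the
    factor \<open>min 1 \<tau>\<close> covers both.\<close>
  have min1: "\<gamma> * min 1 \<tau> * \<zeta> \<le> \<gamma> * \<zeta>" and min2: "\<gamma> * min 1 \<tau> * \<zeta> \<le> \<gamma> * (\<tau> * \<zeta>)"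
    using pos by (simp_all add: mult.assoc)
  consider (2) "f wt \<le> f w - \<gamma> * \<zeta>" | (3) "\<not> f wt \<le> f w - \<gamma> * \<zeta>" "norm d \<le> \<tau> * \<zeta>"
    | (4) "\<not> f wt \<le> f w - \<gamma> * \<zeta>" "\<not> norm d \<le> \<tau> * \<zeta>"
    by blast
  then show ?thesis
  proof cases
    case 2
    then have "\<zeta>' = \<zeta>" "\<alpha> = \<zeta>"
      using step by (simp_all add: cma_stepsizes_def)
    then show ?thesis
      using 2 min1 wt by (intro kept) auto
  next
    case 3
    then have "\<zeta>' = \<theta> * \<zeta>" "\<alpha> = (if f wt \<le> f w0 then \<zeta> else 0)"
      using step by (simp_all add: cma_stepsizes_def)
    then show ?thesis
      using 3 wt w by (intro reduced) auto
  next
    case 4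
    then obtain \<alpha>t where \<alpha>t: "edfl f w d \<zeta> \<gamma> \<delta> = Some \<alpha>t"
      and eq: "if \<alpha>t * (norm d)\<^sup>2 \<le> \<tau> * \<zeta> then
            \<zeta>' = \<theta> * \<zeta> \<and>
            \<alpha> = (if \<alpha>t > 0 then \<alpha>t
                 else if \<alpha>t = 0 \<and> f wt \<le> f w0 then \<zeta>
                 else 0)
          else \<zeta>' = \<zeta> \<and> \<alpha> = \<alpha>t"
      using step by (auto simp: cma_stepsizes_def)
    from \<alpha>t pos(1,4) show ?thesis
    proof (cases rule: edfl_cases)
      \<comment> \<open>With \<open>\<alpha>t = 0\<close> the test
        \<open>\<alpha>t * (norm d)\<^sup>2 \<le> \<tau> * \<zeta>\<close> holds automatically, so a
        rejection always reduces the stepsize.\<close>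
      case rejected
      then have "insufficient_decrease f \<tau> \<gamma> \<delta> w \<zeta> d 0 \<zeta>"
        using pos by (simp add: insufficient_decrease_def)
      then show ?thesis
        using rejected eq pos wt w by (intro reduced) (auto split: if_splits)
    next
      case accepted
      show ?thesis
      proof (cases "\<alpha>t * (norm d)\<^sup>2 \<le> \<tau> * \<zeta>")
        case True
        have b: "\<alpha>t < \<alpha>t / \<delta>" "\<alpha>t / \<delta> * (norm d)\<^sup>2 \<le> \<tau> * \<zeta> / \<delta>"
          using accepted pos True by (simp_all add: field_simps)
        \<comment> \<open>Needed when \<open>f (w + \<alpha>t *\<^sub>R d)\<close> is the term of
          the minimum exceeded: \<open>f\<close> then increases from \<open>\<alpha>t\<close> to
          \<open>\<alpha>t / \<delta>\<close>, and an increase lies above any nonpositive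
          bound.\<close>
        have "0 \<le> \<gamma> * (\<alpha>t / \<delta> - \<alpha>t) * (norm d)\<^sup>2"
          using b pos by simp
        then have "insufficient_decrease f \<tau> \<gamma> \<delta> w \<zeta> d 0 (\<alpha>t / \<delta>)
          \<or> insufficient_decrease f \<tau> \<gamma> \<delta> w \<zeta> d \<alpha>t (\<alpha>t / \<delta>)"
          using accepted b unfolding insufficient_decrease_def min_less_iff_disj by auto
        moreover have "0 \<le> \<gamma> * \<alpha>t * (norm d)\<^sup>2"
          using accepted pos by simp
        ultimately show ?thesis
          using accepted eq True w by (intro reduced) auto
      next
        case False
        then have "\<gamma> * (\<tau> * \<zeta>) \<le> \<gamma> * (\<alpha>t * (norm d)\<^sup>2)"
          using pos by (intro mult_left_mono) auto
        then show ?thesis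
          using accepted eq False min2 by (intro kept) (auto simp: mult.assoc)
      qed
    qed
  qed
qed

section \<open>Stationarity at limits of failed decreases\<close>

lemma insufficient_decrease_limit:
  fixes x :: "'a::euclidean_space"
  assumes C1: "continuously_differentiable f"
    and par: "0 < \<tau>" "\<gamma> < 1" "0 < \<delta>"
    and w: "w \<longlonglongrightarrow> x" and \<zeta>: "\<zeta> \<longlonglongrightarrow> 0" "\<And>k. 0 < \<zeta> k" and d: "d \<longlonglongrightarrow> - gradient f x"
    and fail: "\<And>k. norm (d k) \<le> \<tau> * \<zeta> k \<or> (\<exists>a b. insufficient_decrease f \<tau> \<gamma> \<delta> (w k) (\<zeta> k) (d k) a b)"
  shows "gradient f x = 0"
proof (rule ccontr)
  assume nz: "gradient f x \<noteq> 0"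
  \<comment> \<open>Half the limit of \<open>(norm (d k))\<^sup>2\<close>, hence eventually a strict
    lower bound for it.\<close>
  define c where "c = (norm (gradient f x))\<^sup>2 / 2"
  have c: "0 < c" "c < (norm (- gradient f x))\<^sup>2"
    using nz by (simp_all add: c_def)
  have GD: "GDERIV f u :> gradient f u" for u
    using C1 by (intro differentiable_imp_GDERIV_gradient) (simp add: continuously_differentiable_def)
  have "(\<lambda>k. norm (d k) - \<tau> * \<zeta> k) \<longlonglongrightarrow> norm (- gradient f x) - \<tau> * 0"
    using d \<zeta>(1) by (intro tendsto_intros)
  \<comment> \<open>This eventually excludes the first alternative of \<open>fail\<close>.\<close>
  then have ev1: "\<forall>\<^sub>F k in sequentially. 0 < norm (d k) - \<tau> * \<zeta> k"
    by (rule order_tendstoD) (use nz in simp)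
  have "(\<lambda>k. (norm (d k))\<^sup>2) \<longlonglongrightarrow> (norm (- gradient f x))\<^sup>2"
    using d by (intro tendsto_intros)
  then have ev2: "\<forall>\<^sub>F k in sequentially. c < (norm (d k))\<^sup>2"
    by (rule order_tendstoD) (use c in simp)
  \<comment> \<open>Chosen so that \<open>b \<le> C * \<zeta> k\<close> in both cases: the summand 1
    serves \<open>b \<le> \<zeta> k\<close>, the other comes from dividing the bound on
    \<open>b * (norm (d k))\<^sup>2\<close> by \<open>c\<close>.\<close>
  define C where "C = 1 + \<tau> / (\<delta> * c)"
  have "\<forall>\<^sub>F k in sequentially. \<exists>t. \<bar>t\<bar> \<le> C * \<zeta> k \<and>
      gradient f (w k + t *\<^sub>R d k) \<bullet> d k \<ge> - \<gamma> * (norm (d k))\<^sup>2"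
    using ev1 ev2
  proof eventually_elim
    case (elim k)
    then obtain a b where "insufficient_decrease f \<tau> \<gamma> \<delta> (w k) (\<zeta> k) (d k) a b"
      using fail[of k] by auto
    then have ab: "0 \<le> a" "a < b" "b \<le> \<zeta> k \<or> b * (norm (d k))\<^sup>2 \<le> \<tau> * \<zeta> k / \<delta>"
      and le: "f (w k + b *\<^sub>R d k) - f (w k + a *\<^sub>R d k) \<ge> - \<gamma> * (b - a) * (norm (d k))\<^sup>2"
      by (simp_all add: insufficient_decrease_def)
    obtain t where t: "a < t" "t < b"
      and eq: "f (w k + b *\<^sub>R d k) - f (w k + a *\<^sub>R d k) = (b - a) * (gradient f (w k + t *\<^sub>R d k) \<bullet> d k)"
      using GDERIV_mvt_segment[OF GD \<open>a < b\<close>] by metis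
    have "(b - a) * (- \<gamma> * (norm (d k))\<^sup>2) \<le> (b - a) * (gradient f (w k + t *\<^sub>R d k) \<bullet> d k)"
      using le eq by (simp add: algebra_simps)
    then have "- \<gamma> * (norm (d k))\<^sup>2 \<le> gradient f (w k + t *\<^sub>R d k) \<bullet> d k"
      using \<open>a < b\<close> by (simp only: mult_le_cancel_left_pos diff_gt_0_iff_gt)
    moreover have "b \<le> C * \<zeta> k"
      using ab(3)
    proof
      assume "b \<le> \<zeta> k"
      also have "\<zeta> k \<le> C * \<zeta> k"
        using par c \<zeta>(2)[of k] by (simp add: C_def)
      finally show ?thesis .
    next
      have "b * c \<le> b * (norm (d k))\<^sup>2"
        using ab elim by (intro mult_left_mono) auto
      also assume "b * (norm (d k))\<^sup>2 \<le> \<tau> * \<zeta> k / \<delta>"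
      finally have "b \<le> \<tau> / (\<delta> * c) * \<zeta> k"
        using par c by (simp add: field_simps)
      also have "\<dots> \<le> C * \<zeta> k"
        using \<zeta>(2)[of k] by (simp add: C_def algebra_simps)
      finally show ?thesis .
    qed
    ultimately show ?case
      using t ab by (intro exI[of _ t]) auto
  qed
  then obtain t where t: "\<forall>\<^sub>F k in sequentially. \<bar>t k\<bar> \<le> C * \<zeta> k \<and>
      gradient f (w k + t k *\<^sub>R d k) \<bullet> d k \<ge> - \<gamma> * (norm (d k))\<^sup>2"
    unfolding eventually_ex by blast
  have "(\<lambda>k. C * \<zeta> k) \<longlonglongrightarrow> 0"
    using tendsto_mult_right_zero[OF \<zeta>(1)] .
  then have "t \<longlonglongrightarrow> 0"
    by (rule Lim_null_comparison[rotated]) (use t in \<open>auto elim: eventually_mono\<close>)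
  then have "(\<lambda>k. w k + t k *\<^sub>R d k) \<longlonglongrightarrow> x + 0 *\<^sub>R (- gradient f x)"
    using w d by (intro tendsto_intros)
  moreover have "isCont (gradient f) x"
    using C1 by (simp add: continuously_differentiable_def continuous_on_eq_continuous_at)
  ultimately have "(\<lambda>k. gradient f (w k + t k *\<^sub>R d k)) \<longlonglongrightarrow> gradient f x"
    using isCont_tendsto_compose by fastforce
  then have "(\<lambda>k. gradient f (w k + t k *\<^sub>R d k) \<bullet> d k) \<longlonglongrightarrow> gradient f x \<bullet> (- gradient f x)"
    using d by (intro tendsto_intros)
  moreover have "(\<lambda>k. - \<gamma> * (norm (d k))\<^sup>2) \<longlonglongrightarrow> - \<gamma> * (norm (- gradient f x))\<^sup>2"
    using d by (intro tendsto_intros)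
  \<comment> \<open>Since \<open>d\<close> tends to the negative gradient, the right-hand side is
    minus the squared gradient norm; this is where \<open>\<gamma> < 1\<close> becomes
    decisive.\<close>
  ultimately have "- \<gamma> * (norm (- gradient f x))\<^sup>2 \<le> gradient f x \<bullet> (- gradient f x)"
    by (rule tendsto_le[OF sequentially_bot]) (use t in \<open>auto elim: eventually_mono\<close>)
  then have "(norm (gradient f x))\<^sup>2 \<le> \<gamma> * (norm (gradient f x))\<^sup>2"
    by (simp add: power2_norm_eq_inner)
  with nz par show False
    by simp
qed

section \<open>Descent and shrinking of real sequences\<close>

lemma no_linear_decrease:
  fixes g :: "nat \<Rightarrow> real"
  assumes "0 < c" "\<And>k. m \<le> g k" "\<And>k. N \<le> k \<Longrightarrow> g (Suc k) \<le> g k - c"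
  shows False
proof -
  have le: "g (N + j) \<le> g N - real j * c" for j
  proof (induction j)
    case (Suc j)
    then show ?case
      using assms(3)[of "N + j"] by (simp add: algebra_simps)
  qed simp
  obtain j where "g N - m < real j * c"
    using reals_Archimedean3[OF \<open>0 < c\<close>] by blast
  with le[of j] assms(2)[of "N + j"] show False
    by linarith
qed

text \<open>The sequence is decreasing and positive, so it has a limit \<open>l\<close>; passing to
  the limit along the drops gives \<open>l = \<theta> * l\<close>, which forces
  \<open>l = 0\<close>.\<close>

lemma geometric_drops_tendsto_0:
  fixes \<zeta> :: "nat \<Rightarrow> real" and r :: "nat \<Rightarrow> nat"
  assumes pos: "\<And>k. 0 < \<zeta> k" and "\<theta> < 1"
    and step: "\<And>k. \<zeta> (Suc k) = \<zeta> k \<or> \<zeta> (Suc k) = \<theta> * \<zeta> k"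
    and r: "strict_mono r" "\<And>k. \<zeta> (Suc (r k)) = \<theta> * \<zeta> (r k)"
  shows "\<zeta> \<longlonglongrightarrow> 0"
proof -
  have "\<zeta> (Suc k) \<le> \<zeta> k" for k
    using step[of k] pos[of k] \<open>\<theta> < 1\<close> by auto
  then have "decseq \<zeta>"
    by (simp add: decseq_Suc_iff)
  then obtain l where l: "\<zeta> \<longlonglongrightarrow> l"
    using decseq_convergent[of \<zeta> 0] pos by (metis less_imp_le)
  have lr: "(\<lambda>k. \<zeta> (r k)) \<longlonglongrightarrow> l"
    using LIMSEQ_subseq_LIMSEQ[OF l r(1)] by (simp add: o_def)
  have "(\<lambda>k. \<zeta> (Suc (r k))) \<longlonglongrightarrow> l"
    using LIMSEQ_subseq_LIMSEQ[OF LIMSEQ_Suc[OF l] r(1)] by (simp add: o_def)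
  moreover have "(\<lambda>k. \<zeta> (Suc (r k))) \<longlonglongrightarrow> \<theta> * l"
    unfolding r(2) using lr by (intro tendsto_intros)
  ultimately have "l = \<theta> * l"
    by (rule LIMSEQ_unique)
  with \<open>\<theta> < 1\<close> l show ?thesis
    by simp
qed

section \<open>A stationary limit point of the run\<close>

theorem proposition7:
  fixes fs :: "nat \<Rightarrow> real ^ 'n \<Rightarrow> real" and P :: nat
    and f :: "real ^ 'n \<Rightarrow> real"
    and L \<zeta>0 \<theta> \<tau> \<gamma> \<delta> :: real
    and w :: "nat \<Rightarrow> real ^ 'n"
  assumes f_eq: "f = total_sum fs P"
    and C1: "\<And>p. p \<in> {1..P} \<Longrightarrow> continuously_differentiable (fs p)"
    and level_compact: "\<And>w0. compact {v. f v \<le> f w0}"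
    and L_pos: "L > 0"
    and Lipschitz: "\<And>p u v. p \<in> {1..P} \<Longrightarrow>
          norm (gradient (fs p) u - gradient (fs p) v) \<le> L * norm (u - v)"
    and params: "\<zeta>0 > 0" "\<theta> \<in> {0<..<1}" "\<tau> > 0" "\<gamma> \<in> {0<..<1}" "\<delta> \<in> {0<..<1}"
    and run: "cma_sequence fs P \<zeta>0 \<theta> \<tau> \<gamma> \<delta> w"
  shows "(\<exists>wbar. seq_limit_point w wbar) \<and>
         (\<exists>wbar. seq_limit_point w wbar \<and> gradient f wbar = 0)"
proof -
  have C1f: "continuously_differentiable f"
    unfolding f_eq using C1 by (rule continuously_differentiable_total_sum)
  have grad_f: "gradient f x = (\<Sum>p=1..P. gradient (fs p) x)" for x
    unfolding f_eq using C1 by (rule gradient_total_sum)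
  from run obtain \<zeta> wt d \<alpha> where \<zeta>0: "\<zeta> 0 = \<zeta>0"
    and cyc: "\<And>k. inner_cycle fs P (w k) (\<zeta> k) (wt k) (d k)"
    and step: "\<And>k. cma_stepsizes f \<theta> \<tau> \<gamma> \<delta> (w 0) (w k) (\<zeta> k) (wt k) (d k) (\<zeta> (Suc k)) (\<alpha> k)"
    and next_le: "\<And>k. f (w (Suc k)) \<le> f (w k + \<alpha> k *\<^sub>R d k)"
    unfolding cma_sequence_def f_eq by metis
  define reduced where "reduced k \<longleftrightarrow> \<zeta> (Suc k) = \<theta> * \<zeta> k \<and>
    (norm (d k) \<le> \<tau> * \<zeta> k \<or> (\<exists>a b. insufficient_decrease f \<tau> \<gamma> \<delta> (w k) (\<zeta> k) (d k) a b))" for k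
  define kept where "kept k \<longleftrightarrow>
    \<zeta> (Suc k) = \<zeta> k \<and> f (w (Suc k)) \<le> f (w k) - \<gamma> * min 1 \<tau> * \<zeta> k" for k
  have \<gamma>\<delta>: "0 < \<gamma>" "0 < \<delta>" "\<delta> < 1"
    using params by auto
  \<comment> \<open>Stated conditionally because positivity of the stepsize and membership in the
    level set are themselves propagated by it, in the induction that follows.\<close>
  have iteration: "(kept k \<or> reduced k) \<and> f (w (Suc k)) \<le> f (w 0)"
    if "0 < \<zeta> k" "f (w k) \<le> f (w 0)" for k
    using step[of k] inner_cycle_endpoint[OF cyc[of k]] that(1) params(3) \<gamma>\<delta> that(2)
  proof (cases rule: cma_stepsizes_cases)
    case kept
    moreover have "0 \<le> \<gamma> * min 1 \<tau> * \<zeta> k"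
      using params that by simp
    ultimately show ?thesis
      unfolding kept_def using next_le[of k] that by auto
  next
    case reduced
    then show ?thesis
      unfolding reduced_def using next_le[of k] by auto
  qed
  have invariant: "0 < \<zeta> k \<and> f (w k) \<le> f (w 0)" for k
  proof (induction k)
    case (Suc k)
    with iteration[of k] params show ?case
      by (auto simp: kept_def reduced_def)
  qed (use params \<zeta>0 in auto)
  then have \<zeta>_pos: "0 < \<zeta> k" and dichotomy: "kept k \<or> reduced k" for k
    using iteration by auto
  have level: "w k \<in> {v. f v \<le> f (w 0)}" for k
    using invariant by simp
  have "continuous_on {v. f v \<le> f (w 0)} f"
    using C1f by (intro differentiable_imp_continuous_on)
      (auto simp: differentiable_on_def continuously_differentiable_def intro: differentiable_at_withinI)
  then obtain m where m: "\<And>k. m \<le> f (w k)"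
    using continuous_attains_inf[OF level_compact[of "w 0"]] level by blast

  \<comment> \<open>Otherwise the stepsize is constant from some \<open>N\<close> on, and every
    later iteration lowers \<open>f\<close> by the same positive amount, against the lower bound
    \<open>m\<close>.\<close>
  have "infinite {k. reduced k}"
  proof
    assume "finite {k. reduced k}"
    then obtain N where "\<And>k. reduced k \<Longrightarrow> k < N"
      by (auto simp: finite_nat_set_iff_bounded)
    then have kept: "kept k" if "N \<le> k" for k
      using dichotomy[of k] that by fastforce
    have const: "\<zeta> k = \<zeta> N" if "N \<le> k" for k
      using that by (induction rule: dec_induct) (use kept in \<open>auto simp: kept_def\<close>)
    show False
    proof (rule no_linear_decrease[where g = "\<lambda>k. f (w k)"])
      show "0 < \<gamma> * min 1 \<tau> * \<zeta> N"
        using params \<zeta>_pos by simp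
      show "f (w (Suc k)) \<le> f (w k) - \<gamma> * min 1 \<tau> * \<zeta> N" if "N \<le> k" for k
        using kept[OF that] const[OF that] by (simp add: kept_def)
    qed (rule m)
  qed
  then obtain r :: "nat \<Rightarrow> nat" where r: "strict_mono r" "\<And>k. reduced (r k)"
    using infinite_enumerate by blast
  have \<zeta>_0: "\<zeta> \<longlonglongrightarrow> 0"
  proof (rule geometric_drops_tendsto_0[OF \<zeta>_pos _ _ r(1)])
    show "\<zeta> (Suc k) = \<zeta> k \<or> \<zeta> (Suc k) = \<theta> * \<zeta> k" for k
      using dichotomy[of k] unfolding kept_def reduced_def by blast
    show "\<zeta> (Suc (r k)) = \<theta> * \<zeta> (r k)" for k
      using r(2)[of k] unfolding reduced_def by blast
  qed (use params in simp)
  \<comment> \<open>Compactness is applied to the reduced iterations only, so that every index of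
    the convergent subsequence carries a recorded failure.\<close>
  obtain x s where s: "strict_mono s" and lim: "((w \<circ> r) \<circ> s) \<longlonglongrightarrow> x"
    using seq_compactE[OF compact_imp_seq_compact[OF level_compact[of "w 0"]], of "w \<circ> r"] level
    by (metis comp_apply)
  define q where "q = r \<circ> s"
  have q: "strict_mono q" "\<And>k. reduced (q k)"
    using strict_mono_o[OF r(1) s] r(2) by (simp_all add: q_def)
  have wq: "(\<lambda>k. w (q k)) \<longlonglongrightarrow> x"
    using lim by (simp add: q_def comp_def)
  have \<zeta>q: "(\<lambda>k. \<zeta> (q k)) \<longlonglongrightarrow> 0"
    using LIMSEQ_subseq_LIMSEQ[OF \<zeta>_0 q(1)] by (simp add: comp_def)
  have "(\<lambda>k. d (q k)) \<longlonglongrightarrow> - (\<Sum>p=1..P. gradient (fs p) x)"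
    using cyc Lipschitz wq \<zeta>q by (rule inner_cycle_direction_tendsto)
  then have "(\<lambda>k. d (q k)) \<longlonglongrightarrow> - gradient f x"
    unfolding grad_f .
  then have "gradient f x = 0"
    by (rule insufficient_decrease_limit[OF C1f _ _ _ wq \<zeta>q, rotated 4, where \<tau> = \<tau> and \<gamma> = \<gamma> and \<delta> = \<delta>])
      (use params \<zeta>_pos q(2) in \<open>auto simp: reduced_def\<close>)
  moreover have "seq_limit_point w x"
    unfolding seq_limit_point_def using q(1) wq by (auto simp: comp_def)
  ultimately show ?thesis
    by blast
qed

end
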